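(* Let $\nu$ be a non-atomic Borel probability measure on $\mathbb{T}^1$. If $f : \mathbb{T}^1 \to \mathbb{T}^1$ is a $\nu$-preserving homeomorphism, then the dynamical system $(\mathbb{T}^1, \nu, \mathbb{N}, f)$ does not have the shrinking target property (STP).
   Context: $\mathbb{T}^1 = \mathbb{R}/\mathbb{Z}$ with its usual quotient metric; $B(x,\rho)$ is the open ball ($B(x,0)=\emptyset$). $\mathbb{N}$ is the usual additive semigroup, acting by the iterates $f^n$. A system $(M,\nu,\mathbb{N},f)$, with $M$ a metric space, $\nu$ a finite Borel measure on $M$ and $f : M \to M$ a $\nu$-preserving map, has STP if for every $x \in M$ and every radius sequence $r : \mathbb{N} \to \mathbb{R}_{\geq 0}$ (no monotonicity required), with $r_n := r(n)$, such that $\sum_{n \in \mathbb{N}} \nu(B(x, r_n)) = \infty$, one has $\nu(\limsup_n f^{-n}B(x, r_n)) = \nu(M)$, where $f^{-n}B(x,r_n)$ is the preimage under $f^n$ and $\limsup_n f^{-n}B(x,r_n)$ is the set of points lying in $f^{-n}B(x,r_n)$ for infinitely many $n$. *)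

theory Defs
  imports "HOL-Probability.Probability"
begin

section \<open>The circle R/Z as a metric space\<close>

quotient_type circle = real / "\<lambda>x y :: real. x - y \<in> \<int>"
  morphisms rep_circle to_circle
proof (rule equivpI)
  show "reflp (\<lambda>x y :: real. x - y \<in> \<int>)" by (auto simp: reflp_def)
  show "symp (\<lambda>x y :: real. x - y \<in> \<int>)"
    by (auto simp: symp_def intro: Ints_minus dest: Ints_minus)
  show "transp (\<lambda>x y :: real. x - y \<in> \<int>)"
  proof (rule transpI)
    fix x y z :: real assume "x - y \<in> \<int>" "y - z \<in> \<int>"
    then have "(x - y) + (y - z) \<in> \<int>" by (rule Ints_add)
    then show "x - z \<in> \<int>" by simp
  qed
qed

lemma to_circle_eq_iff: "to_circle x = to_circle y \<longleftrightarrow> x - y \<in> \<int>"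
  by (fact circle.abs_eq_iff)

lemma to_circle_surj: "\<exists>x. p = to_circle x"
  by (metis Quotient3_abs_rep Quotient3_circle)

text \<open>
  The usual quotient metric: the distance of two cosets of the integers is the infimum of the
  distances between their representatives.
\<close>

instantiation circle :: metric_space
begin

definition dist_circle :: "circle \<Rightarrow> circle \<Rightarrow> real" where
  "dist_circle p q = Inf {\<bar>s - t\<bar> | s t. to_circle s = p \<and> to_circle t = q}"

definition uniformity_circle :: "(circle \<times> circle) filter" where
  "uniformity_circle = (INF e\<in>{0 <..}. principal {(p, q). dist p q < e})"

definition open_circle :: "circle set \<Rightarrow> bool" where
  "open_circle U = (\<forall>p\<in>U. eventually (\<lambda>(p', q). p' = p \<longrightarrow> q \<in> U) uniformity)"

lemma dist_to_circle:
  "dist (to_circle x) (to_circle y) = \<bar>(x - y) - of_int (round (x - y))\<bar>"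
  unfolding dist_circle_def
proof (rule cInf_eq_minimum)
  have "to_circle (x - of_int (round (x - y))) = to_circle x"
    by (simp add: to_circle_eq_iff)
  moreover have "\<bar>(x - y) - of_int (round (x - y))\<bar> = \<bar>(x - of_int (round (x - y))) - y\<bar>"
    by (simp add: algebra_simps)
  ultimately show "\<bar>(x - y) - of_int (round (x - y))\<bar>
      \<in> {\<bar>s - t\<bar> | s t. to_circle s = to_circle x \<and> to_circle t = to_circle y}"
    by blast
next
  fix d assume "d \<in> {\<bar>s - t\<bar> | s t. to_circle s = to_circle x \<and> to_circle t = to_circle y}"
  then obtain s t where d: "d = \<bar>s - t\<bar>" "s - x \<in> \<int>" "t - y \<in> \<int>"
    by (auto simp: to_circle_eq_iff)
  then obtain m n where "s - x = of_int m" "t - y = of_int n" by (auto elim!: Ints_cases)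
  then have "s - t = (x - y) - of_int (n - m)" by simp
  then show "\<bar>(x - y) - of_int (round (x - y))\<bar> \<le> d"
    using round_diff_minimal[of "x - y" "n - m"] d by simp
qed

instance
proof
  fix p q r :: circle
  obtain x y z where [simp]: "p = to_circle x" "q = to_circle y" "r = to_circle z"
    using to_circle_surj by metis
  show "dist p q = 0 \<longleftrightarrow> p = q"
  proof
    assume "dist p q = 0"
    then have "x - y = of_int (round (x - y))" by (simp add: dist_to_circle)
    then have "x - y \<in> \<int>" by (metis Ints_of_int)
    then show "p = q" by (simp add: to_circle_eq_iff)
  next
    assume "p = q"
    then show "dist p q = 0" by (auto simp: dist_to_circle to_circle_eq_iff elim!: Ints_cases)
  qed
  define m n where "m = round (x - z)" and "n = round (y - z)"
  have "\<bar>(x - y) - of_int (round (x - y))\<bar> \<le> \<bar>(x - y) - of_int (m - n)\<bar>"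
    by (rule round_diff_minimal)
  also have "\<dots> \<le> \<bar>(x - z) - of_int m\<bar> + \<bar>(y - z) - of_int n\<bar>" by simp
  finally show "dist p q \<le> dist p r + dist q r" by (simp add: dist_to_circle m_def n_def)
qed (simp_all add: uniformity_circle_def open_circle_def)

end


section \<open>Measure-preserving systems and the shrinking target property\<close>

definition nonatomic :: "'a measure \<Rightarrow> bool" where
  "nonatomic \<nu> \<longleftrightarrow>
    \<not> (\<exists>A\<in>sets \<nu>. emeasure \<nu> A > 0 \<and>
         (\<forall>B\<in>sets \<nu>. B \<subseteq> A \<longrightarrow> emeasure \<nu> B = 0 \<or> emeasure \<nu> B = emeasure \<nu> A))"

definition preserves_measure :: "'a measure \<Rightarrow> ('a \<Rightarrow> 'a) \<Rightarrow> bool" where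
  "preserves_measure \<nu> f \<longleftrightarrow>
    f \<in> measurable \<nu> \<nu> \<and> (\<forall>A\<in>sets \<nu>. emeasure \<nu> (f -` A \<inter> space \<nu>) = emeasure \<nu> A)"

text \<open>
  The limsup of a sequence of sets \<open>A n\<close> is written out as the set of points lying in \<open>A n\<close> for
  infinitely many \<open>n\<close>, and the divergence of the sum of measures is taken in the extended
  nonnegative reals. The predicate is meant for a finite Borel measure \<open>\<nu>\<close> on a metric space
  and a map \<open>f\<close> preserving \<open>\<nu>\<close>. Radius 0 is allowed (\<open>ball x 0\<close> is empty).
\<close>

definition has_STP :: "('a :: metric_space) measure \<Rightarrow> ('a \<Rightarrow> 'a) \<Rightarrow> bool" where
  "has_STP \<nu> f \<longleftrightarrow>
    (\<forall>x. \<forall>r :: nat \<Rightarrow> real. (\<forall>n. r n \<ge> 0) \<longrightarrow>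
       (\<Sum>n. emeasure \<nu> (ball x (r n))) = \<infinity> \<longrightarrow>
       emeasure \<nu> {y. \<exists>\<^sub>\<infinity>n. y \<in> (f ^^ n) -` ball x (r n)} = emeasure \<nu> (space \<nu>))"

end

theory Submission
  imports Defs
begin

text \<open>
  A ball \<open>A = B(x, \<rho>)\<close> of small positive measure \<open>m\<close> meets \<open>f\<^sup>-\<^sup>n A\<close> for infinitely many \<open>n\<close>
  (Poincare recurrence). For such \<open>n\<close> the set \<open>A \<union> f\<^sup>-\<^sup>n A\<close> is connected, contains \<open>x\<close> and has
  measure at most \<open>2m\<close>; and the connected sets through \<open>x\<close> of measure at most \<open>c\<close> all lie in a
  set of measure at most \<open>2c\<close>, because a connected subset of the circle through \<open>x\<close> and \<open>y\<close>
  contains one of the two arcs from \<open>x\<close> to \<open>y\<close>. So if \<open>4m < 1\<close>, the radii \<open>r\<^sub>n = \<rho>\<close> at the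
  return times and \<open>r\<^sub>n = 0\<close> otherwise contradict STP.
\<close>

section \<open>Sublevel sets of the distribution function\<close>

text \<open>The sets where \<open>X\<close> is at most \<open>t\<close> increase with
  \<open>t\<close>, so the levels whose set has measure at most \<open>c\<close> are closed
  downwards. Continuity from below along a cofinal sequence of such levels keeps the bound
  \<open>c\<close>.\<close>

lemma (in finite_measure) measure_distribution_le:
  fixes X :: "'a \<Rightarrow> real"
  assumes X [measurable]: "X \<in> borel_measurable M" and c: "0 \<le> c"
  shows "\<exists>S\<in>sets M. measure M S \<le> c \<and>
    {y\<in>space M. measure M {z\<in>space M. X z \<le> X y} \<le> c} \<subseteq> S"
proof -
  define T where "T = {t. measure M {z\<in>space M. X z \<le> t} \<le> c}"
  have down: "s \<in> T" if "t \<in> T" "s \<le> t" for s t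
  proof -
    have "measure M {z\<in>space M. X z \<le> s} \<le> measure M {z\<in>space M. X z \<le> t}"
      using that by (intro finite_measure_mono) auto
    then show ?thesis using that unfolding T_def by simp
  qed
  \<comment> \<open>It is enough to exhaust \<open>T\<close> by an increasing sequence. The nonempty
    cases below are \<open>T\<close> unbounded, with a greatest element, and with a supremum that it
    misses.\<close>
  have seq: "\<exists>S\<in>sets M. measure M S \<le> c \<and> {y\<in>space M. X y \<in> T} \<subseteq> S"
    if t: "\<And>n. t n \<in> T" "incseq t" "\<And>s. s \<in> T \<Longrightarrow> \<exists>n. s \<le> t n" for t :: "nat \<Rightarrow> real"
  proof (intro bexI conjI)
    let ?A = "\<lambda>n. {z\<in>space M. X z \<le> t n}"
    have "(\<lambda>n. measure M (?A n)) \<longlonglongrightarrow> measure M (\<Union>n. ?A n)"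
      using t(2) by (intro finite_Lim_measure_incseq) (auto simp: incseq_def intro: order_trans)
    then show "measure M (\<Union>n. ?A n) \<le> c"
      by (rule LIMSEQ_le_const2) (use t(1) in \<open>auto simp: T_def\<close>)
    show "{y\<in>space M. X y \<in> T} \<subseteq> (\<Union>n. ?A n)" using t(3) by auto
  qed measurable
  have "\<exists>S\<in>sets M. measure M S \<le> c \<and> {y\<in>space M. X y \<in> T} \<subseteq> S"
  proof (cases "T = {}")
    case True
    then show ?thesis using c by (intro bexI[of _ "{}"]) auto
  next
    case nonempty: False
    show ?thesis
    proof (cases "bdd_above T")
      case False
      then have "\<exists>s\<in>T. t < s" for t
        by (meson bdd_above.I not_le)
      then have "real n \<in> T" for n by (meson down less_imp_le)
      then show ?thesis by (intro seq[of real]) (auto simp: incseq_def real_arch_simple)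
    next
      case True
      show ?thesis
      proof (cases "Sup T \<in> T")
        case sup: True
        then show ?thesis using True by (intro seq[of "\<lambda>_. Sup T"]) (auto intro: cSup_upper)
      next
        case False
        \<comment> \<open>As \<open>T\<close> misses its supremum, each element lies strictly below
          it and is overtaken; the terms are in \<open>T\<close> by downward closure.\<close>
        show ?thesis
        proof (rule seq[of "\<lambda>n. Sup T - inverse (real (Suc n))"])
          fix n
          have "Sup T - inverse (real (Suc n)) < Sup T" by simp
          then show "Sup T - inverse (real (Suc n)) \<in> T"
            by (meson down less_cSup_iff True nonempty less_imp_le)
        next
          show "incseq (\<lambda>n. Sup T - inverse (real (Suc n)))"
            by (auto simp: incseq_def intro!: le_imp_inverse_le)
        next
          fix s assume s: "s \<in> T"
          then have "s < Sup T" using False True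
            by (metis cSup_upper order_le_less)
          then show "\<exists>n. s \<le> Sup T - inverse (real (Suc n))"
            using reals_Archimedean[of "Sup T - s"] by (auto simp: algebra_simps intro: less_imp_le)
        qed
      qed
    qed
  qed
  then show ?thesis by (simp add: T_def)
qed

section \<open>Arcs and connected subsets of the circle\<close>

lemma continuous_on_to_circle: "continuous_on S to_circle"
proof -
  have "dist (to_circle s) (to_circle t) \<le> dist s t" for s t
    using round_diff_minimal[of "s - t" 0] by (simp add: dist_to_circle dist_real_def)
  then show ?thesis
    unfolding continuous_on_iff by (meson le_less_trans)
qed

text \<open>\<open>b + of_int (round (a - b))\<close> is a representative of
  \<open>to_circle b\<close> nearest to \<open>a\<close> and realises the quotient distance.
  Connectedness of balls and openness of \<open>to_circle\<close> follow from this.\<close>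

lemma ball_to_circle: "ball (to_circle a) r = to_circle ` ball a r"
proof (intro equalityI subsetI)
  fix p assume p: "p \<in> ball (to_circle a) r"
  obtain b where b: "p = to_circle b" using to_circle_surj by metis
  have "p = to_circle (b + of_int (round (a - b)))" by (simp add: b to_circle_eq_iff)
  moreover have "b + of_int (round (a - b)) \<in> ball a r"
    using p by (simp add: b dist_to_circle dist_real_def algebra_simps)
  ultimately show "p \<in> to_circle ` ball a r" by blast
next
  fix p assume "p \<in> to_circle ` ball a r"
  then obtain b where "p = to_circle b" "\<bar>a - b\<bar> < r" by (auto simp: dist_real_def)
  then show "p \<in> ball (to_circle a) r"
    using round_diff_minimal[of "a - b" 0] by (simp add: dist_to_circle)
qed

lemma connected_ball_circle: "connected (ball (x :: circle) r)"
  by (metis to_circle_surj ball_to_circle connected_continuous_image continuous_on_to_circle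
      convex_connected convex_ball)

lemma open_to_circle_image:
  assumes "open S"
  shows "open (to_circle ` S)"
  unfolding open_contains_ball
proof
  fix p assume "p \<in> to_circle ` S"
  then obtain s where s: "s \<in> S" "p = to_circle s" by auto
  then obtain e where "e > 0" "ball s e \<subseteq> S" using assms by (meson openE)
  then show "\<exists>e>0. ball p e \<subseteq> to_circle ` S" using s by (auto simp: ball_to_circle)
qed

text \<open>The length of the arc from \<open>x\<close> to \<open>y\<close> in the positive
  direction, in [0, 1). It does not depend on the representatives and jumps at
  \<open>x\<close>.\<close>

definition arc_param :: "circle \<Rightarrow> circle \<Rightarrow> real" where
  "arc_param x y = frac (rep_circle y - rep_circle x)"

lemma to_circle_rep: "to_circle (rep_circle x) = x"
  by (metis Quotient3_abs_rep Quotient3_circle)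

lemma arc_param_bounds: "0 \<le> arc_param x y" "arc_param x y < 1"
  by (simp_all add: arc_param_def frac_lt_1)

lemma to_circle_arc_param: "to_circle (rep_circle x + arc_param x y) = y"
proof -
  have "to_circle (rep_circle x + arc_param x y) = to_circle (rep_circle y)"
    by (simp add: to_circle_eq_iff arc_param_def frac_def)
  then show ?thesis by (simp add: to_circle_rep)
qed

lemma arc_param_to_circle:
  assumes "0 \<le> t" "t < 1"
  shows "arc_param x (to_circle (rep_circle x + t)) = t"
proof -
  let ?y = "to_circle (rep_circle x + t)"
  have "to_circle (rep_circle ?y) = ?y" by (rule to_circle_rep)
  then have "rep_circle ?y - (rep_circle x + t) \<in> \<int>" by (simp only: to_circle_eq_iff)
  then have "frac (rep_circle ?y - rep_circle x) = t"
    using assms by (subst frac_unique_iff) (simp add: algebra_simps)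
  then show ?thesis by (simp add: arc_param_def)
qed

lemma arc_param_self: "arc_param x x = 0"
  by (simp add: arc_param_def)

lemma arc_param_eq_iff: "arc_param x y = arc_param x z \<longleftrightarrow> y = z"
  by (metis to_circle_arc_param)

text \<open>Since the coordinate jumps at \<open>x\<close>, preimages are traded for images under
  the inverse parametrisation, which is continuous and open.\<close>

lemma arc_param_image:
  assumes "S \<subseteq> {0..<1}"
  shows "{y. arc_param x y \<in> S} = to_circle ` (\<lambda>t. rep_circle x + t) ` S"
proof (intro equalityI subsetI)
  fix y assume "y \<in> {y. arc_param x y \<in> S}"
  then show "y \<in> to_circle ` (\<lambda>t. rep_circle x + t) ` S"
    by (auto intro!: rev_image_eqI[of "arc_param x y"] simp: image_image to_circle_arc_param)
next
  fix y assume "y \<in> to_circle ` (\<lambda>t. rep_circle x + t) ` S"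
  then show "y \<in> {y. arc_param x y \<in> S}"
    using assms by (auto simp: arc_param_to_circle subset_iff)
qed

lemma compact_arc_param:
  assumes "compact S" "S \<subseteq> {0..<1}"
  shows "compact {y. arc_param x y \<in> S}"
  unfolding arc_param_image[OF assms(2)]
  using assms(1) by (intro compact_continuous_image continuous_on_to_circle continuous_intros)

lemma open_arc_param:
  assumes "open S" "S \<subseteq> {0..<1}"
  shows "open {y. arc_param x y \<in> S}"
  unfolding arc_param_image[OF assms(2)]
  using assms(1) by (intro open_to_circle_image open_translation)

lemma compact_UNIV_circle: "compact (UNIV :: circle set)"
proof -
  have "(UNIV :: circle set) = to_circle ` {0..1}"
  proof (intro equalityI subsetI)
    fix p :: circle
    obtain a where "p = to_circle a" using to_circle_surj by metis
    then have "p = to_circle (frac a)" by (simp add: to_circle_eq_iff frac_def)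
    then show "p \<in> to_circle ` {0..1}"
      by (auto intro!: rev_image_eqI[of "frac a"] simp: frac_lt_1 less_imp_le)
  qed auto
  then show ?thesis
    by (metis compact_continuous_image continuous_on_to_circle compact_Icc)
qed

text \<open>Sublevel sets are empty, compact arcs starting at \<open>x\<close>, or the whole
  circle.\<close>

lemma borel_measurable_arc_param: "arc_param x \<in> borel_measurable borel"
  unfolding borel_measurable_iff_le
proof
  fix t :: real
  consider "t < 0" | "0 \<le> t" "t < 1" | "1 \<le> t" by linarith
  then show "{w \<in> space borel. arc_param x w \<le> t} \<in> sets borel"
  proof cases
    case 1
    then have "{w \<in> space borel. arc_param x w \<le> t} = {}"
      using arc_param_bounds(1) by (auto simp: not_le intro: less_le_trans)
    then show ?thesis by simp
  next
    case 2
    then have "{w \<in> space borel. arc_param x w \<le> t} = {w. arc_param x w \<in> {0..t}}"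
      using arc_param_bounds(1) by auto
    moreover have "compact {w. arc_param x w \<in> {0..t}}"
      using 2 by (intro compact_arc_param) auto
    ultimately show ?thesis by (simp add: borel_compact)
  next
    case 3
    then have "{w \<in> space borel. arc_param x w \<le> t} = UNIV"
      using arc_param_bounds(2) by (auto intro: less_imp_le less_le_trans)
    then show ?thesis by simp
  qed
qed

text \<open>If \<open>D\<close> misses a point \<open>p\<close> of the first arc and a point
  \<open>q\<close> of the second, removing both splits the circle into two open arcs, one around
  \<open>y\<close> and the other around \<open>x\<close>, which disconnects
  \<open>D\<close>.\<close>

lemma connected_contains_arc:
  assumes D: "connected D" "x \<in> D" "y \<in> D"
  shows "{z. arc_param x z \<le> arc_param x y} \<subseteq> D \<or> {z. arc_param x y \<le> arc_param x z} \<subseteq> D"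
proof (rule ccontr)
  let ?u = "arc_param x"
  assume "\<not> ?thesis"
  then obtain p q where p: "p \<notin> D" "?u p \<le> ?u y" and q: "q \<notin> D" "?u y \<le> ?u q" by auto
  have "p \<noteq> x" "p \<noteq> y" "q \<noteq> y" using p q D by auto
  then have u: "0 < ?u p" "?u p < ?u y" "?u y < ?u q" "?u q < 1"
    using p q arc_param_bounds[of x p] arc_param_bounds[of x q]
    by (metis arc_param_eq_iff arc_param_self order_le_less)+
  define U where "U = {z. ?u z \<in> {?u p<..<?u q}}"
  \<comment> \<open>This arc wraps around \<open>x\<close>, where the coordinate jumps, so its
    openness comes from the compactness of the complement.\<close>
  define V where "V = - {z. ?u z \<in> {?u p..?u q}}"
  have "open U" unfolding U_def using u by (intro open_arc_param) auto
  moreover have "open V" unfolding V_def using u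
    by (intro open_Compl compact_imp_closed compact_arc_param) auto
  moreover have "U \<inter> V \<inter> D = {}" by (auto simp: U_def V_def)
  moreover have "D \<subseteq> U \<union> V"
  proof
    fix z assume "z \<in> D"
    then have "?u z \<noteq> ?u p" "?u z \<noteq> ?u q" using p q by (auto simp: arc_param_eq_iff)
    then show "z \<in> U \<union> V" by (auto simp: U_def V_def)
  qed
  moreover have "y \<in> U \<inter> D" using u D by (auto simp: U_def)
  moreover have "x \<in> V \<inter> D" using u D by (auto simp: V_def arc_param_self)
  ultimately show False using D(1) unfolding connected_def by blast
qed

text \<open>Each \<open>y\<close> in \<open>D\<close> cuts off an arc inside \<open>D\<close>, hence
  of measure at most \<open>c\<close>. So \<open>y\<close> is caught by
  \<open>measure_distribution_le\<close> for the coordinate or for its negative, and each of the two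
  costs \<open>c\<close>.\<close>

lemma measure_connected_through_point:
  fixes \<nu> :: "circle measure"
  assumes fin: "finite_measure \<nu>" and sets: "sets \<nu> = sets borel" and c: "0 \<le> c"
  shows "\<exists>S\<in>sets borel. measure \<nu> S \<le> 2 * c \<and>
    (\<forall>D\<in>sets borel. connected D \<longrightarrow> x \<in> D \<longrightarrow> measure \<nu> D \<le> c \<longrightarrow> D \<subseteq> S)"
proof -
  interpret finite_measure \<nu> by fact
  let ?u = "arc_param x"
  have space: "space \<nu> = UNIV" using sets_eq_imp_space_eq[OF sets] by simp
  have [measurable]: "?u \<in> borel_measurable \<nu>"
    using borel_measurable_arc_param measurable_cong_sets[OF sets refl] by blast
  obtain S1 where S1: "S1 \<in> sets \<nu>" "measure \<nu> S1 \<le> c"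
    "{y. measure \<nu> {z. ?u z \<le> ?u y} \<le> c} \<subseteq> S1"
    using measure_distribution_le[of ?u c] c by (auto simp: space)
  \<comment> \<open>Negating the coordinate turns the arcs beyond \<open>y\<close> into sublevel
    sets.\<close>
  obtain S2 where S2: "S2 \<in> sets \<nu>" "measure \<nu> S2 \<le> c"
    "{y. measure \<nu> {z. ?u y \<le> ?u z} \<le> c} \<subseteq> S2"
    using measure_distribution_le[of "\<lambda>z. - ?u z" c] c by (auto simp: space)
  show ?thesis
  proof (intro bexI conjI ballI impI subsetI)
    show "measure \<nu> (S1 \<union> S2) \<le> 2 * c"
      using measure_Un_le[OF S1(1) S2(1)] S1(2) S2(2) by simp
    show "S1 \<union> S2 \<in> sets borel" using S1 S2 sets by auto
    fix D y assume D: "D \<in> sets borel" "connected D" "x \<in> D" "measure \<nu> D \<le> c" and y: "y \<in> D"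
    have "measure \<nu> B \<le> c" if "B \<subseteq> D" for B
      using finite_measure_mono[OF that] D sets by simp
    then show "y \<in> S1 \<union> S2"
      using connected_contains_arc[OF D(2,3) y] S1(3) S2(3) by blast
  qed
qed

section \<open>Measures on the circle\<close>

text \<open>Otherwise every point has a null ball around it, and by compactness finitely many of
  these cover the circle, which would be null.\<close>

lemma exists_support_point:
  fixes \<nu> :: "circle measure"
  assumes sets: "sets \<nu> = sets borel" and pos: "emeasure \<nu> UNIV \<noteq> 0"
  shows "\<exists>x. \<forall>r>0. emeasure \<nu> (ball x r) \<noteq> 0"
proof (rule ccontr)
  assume "\<not> ?thesis"
  then obtain r where r: "\<And>x. r x > 0" "\<And>x. emeasure \<nu> (ball x (r x)) = 0" by metis
  have "UNIV \<subseteq> (\<Union>x\<in>UNIV. ball x (r x))" using r(1) by auto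
  then obtain F where F: "finite F" "UNIV \<subseteq> (\<Union>x\<in>F. ball x (r x))"
    using compactE_image[OF compact_UNIV_circle, of UNIV "\<lambda>x. ball x (r x)"] by auto
  have "(\<Union>x\<in>F. ball x (r x)) \<in> null_sets \<nu>"
    using F(1) r(2) sets by (intro null_sets_UN' countable_finite) (auto intro!: null_setsI)
  then show False using F(2) pos by (metis null_setsD1 top.extremum_uniqueI)
qed

lemma nonatomic_singleton:
  assumes "nonatomic \<nu>" "{x} \<in> sets \<nu>"
  shows "emeasure \<nu> {x} = 0"
proof (rule ccontr)
  assume "emeasure \<nu> {x} \<noteq> 0"
  then have "emeasure \<nu> {x} > 0" by (simp add: zero_less_iff_neq_zero)
  moreover have "\<forall>B\<in>sets \<nu>. B \<subseteq> {x} \<longrightarrow> emeasure \<nu> B = 0 \<or> emeasure \<nu> B = emeasure \<nu> {x}"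
    by (auto simp: subset_singleton_iff)
  ultimately show False using assms unfolding nonatomic_def by blast
qed

lemma exists_ball_small_measure:
  fixes \<nu> :: "'a :: metric_space measure"
  assumes fin: "finite_measure \<nu>" and sets: "sets \<nu> = sets borel"
    and null: "emeasure \<nu> {x} = 0" and e: "0 < e"
  shows "\<exists>r>0. measure \<nu> (ball x r) < e"
proof -
  interpret finite_measure \<nu> by fact
  let ?B = "\<lambda>n. ball x (inverse (real (Suc n)))"
  have "(\<lambda>n. measure \<nu> (?B n)) \<longlonglongrightarrow> measure \<nu> (\<Inter>n. ?B n)"
  proof (rule finite_Lim_measure_decseq)
    show "decseq ?B"
      unfolding decseq_def by (intro allI impI subset_ball le_imp_inverse_le) auto
  qed (auto simp: sets)
  moreover have "(\<Inter>n. ?B n) = {x}"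
  proof (intro equalityI subsetI)
    fix y assume y: "y \<in> (\<Inter>n. ?B n)"
    then have "\<not> 0 < dist x y"
      using reals_Archimedean[of "dist x y"] by (auto dest: less_asym)
    then show "y \<in> {x}" by simp
  qed auto
  ultimately have "(\<lambda>n. measure \<nu> (?B n)) \<longlonglongrightarrow> 0" using null by (simp add: measure_def)
  then have "eventually (\<lambda>n. measure \<nu> (?B n) < e) sequentially"
    using e by (rule order_tendstoD(2))
  then obtain n where "measure \<nu> (?B n) < e" by (auto dest: eventually_happens)
  then show ?thesis by (intro exI[of _ "inverse (real (Suc n))"]) simp
qed

section \<open>Recurrence\<close>

lemma preserves_measure_funpow:
  assumes "preserves_measure \<nu> f"
  shows "preserves_measure \<nu> (f ^^ n)"
proof (induction n)
  case 0
  show ?case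
    by (auto simp: preserves_measure_def id_def dest: sets.sets_into_space
        intro!: arg_cong[of _ _ "emeasure \<nu>"])
next
  case (Suc n)
  have "(f ^^ Suc n) -` A \<inter> space \<nu> = f -` ((f ^^ n) -` A \<inter> space \<nu>) \<inter> space \<nu>" for A
    using measurable_space[of f \<nu> \<nu>] assms
    by (auto simp: preserves_measure_def funpow_swap1)
  moreover have "f ^^ Suc n \<in> measurable \<nu> \<nu>"
    using assms Suc unfolding preserves_measure_def by (auto intro: measurable_comp)
  ultimately show ?case
    using assms Suc unfolding preserves_measure_def by (metis measurable_sets)
qed

text \<open>Poincare recurrence: infinitely many preimages of equal positive measure cannot be
  pairwise disjoint in a finite measure space.\<close>

lemma infinite_return_times:
  assumes fin: "finite_measure \<nu>" and f: "preserves_measure \<nu> f"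
    and A: "A \<in> sets \<nu>" "emeasure \<nu> A \<noteq> 0"
  shows "\<exists>\<^sub>\<infinity>n. (f ^^ n) -` A \<inter> A \<noteq> {}"
  unfolding INFM_nat
proof (intro allI)
  fix N
  interpret finite_measure \<nu> by fact
  \<comment> \<open>Only multiples of \<open>Suc N\<close> are used, so that the difference of two
    distinct times exceeds \<open>N\<close>.\<close>
  define P where "P k = (f ^^ (k * Suc N)) -` A \<inter> space \<nu>" for k
  have P: "P k \<in> sets \<nu>" "emeasure \<nu> (P k) = emeasure \<nu> A" for k
    using preserves_measure_funpow[OF f] A(1)
    unfolding preserves_measure_def P_def by (auto intro: measurable_sets)
  have "\<not> disjoint_family P"
  proof
    assume disj: "disjoint_family P"
    then have "summable (\<lambda>k. measure \<nu> (P k))"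
      using P(1) finite_measure_UNION[of P] by (auto intro: sums_summable)
    then have "summable (\<lambda>k::nat. measure \<nu> A)" using P(2) by (simp add: measure_def)
    then show False using A(2) by (simp add: summable_const_iff emeasure_eq_measure)
  qed
  then obtain i j where "i \<noteq> j" "P i \<inter> P j \<noteq> {}" unfolding disjoint_family_on_def by auto
  then obtain i j where ij: "i < j" "P i \<inter> P j \<noteq> {}" by (metis inf_commute nat_neq_iff)
  then obtain y where y: "y \<in> P i" "y \<in> P j" by auto
  define n where "n = (j - i) * Suc N"
  have "j * Suc N = n + i * Suc N"
    unfolding n_def using ij(1) by (simp add: add_mult_distrib[symmetric] del: mult_Suc_right)
  then have "(f ^^ n) ((f ^^ (i * Suc N)) y) \<in> A"
    using y(2) by (simp add: P_def funpow_add del: mult_Suc_right)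
  then have "(f ^^ (i * Suc N)) y \<in> (f ^^ n) -` A \<inter> A" using y(1) by (simp add: P_def)
  moreover have "n > N" unfolding n_def using ij(1) by (cases "j - i") auto
  ultimately show "\<exists>n>N. (f ^^ n) -` A \<inter> A \<noteq> {}" by blast
qed

text \<open>A preimage under \<open>f\<close> is an image under the continuous inverse
  \<open>g\<close>, and continuous images preserve connectedness.\<close>

lemma connected_vimage_funpow:
  fixes f :: "'a :: topological_space \<Rightarrow> 'a"
  assumes "homeomorphism UNIV UNIV f g" "connected A"
  shows "connected ((f ^^ n) -` A)"
proof (induction n)
  case 0
  show ?case using assms(2) by simp
next
  case (Suc n)
  have "(f ^^ Suc n) -` A = g ` ((f ^^ n) -` A)"
  proof (intro equalityI subsetI)
    fix y assume "y \<in> (f ^^ Suc n) -` A"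
    then have "f y \<in> (f ^^ n) -` A" by (simp add: funpow_swap1)
    then show "y \<in> g ` ((f ^^ n) -` A)"
      using assms(1) by (intro rev_image_eqI[of "f y"]) (auto simp: homeomorphism_def)
  next
    fix y assume "y \<in> g ` ((f ^^ n) -` A)"
    then obtain z where "y = g z" "(f ^^ n) z \<in> A" by blast
    moreover have "f (g z) = z" using assms(1) by (simp add: homeomorphism_def)
    ultimately show "y \<in> (f ^^ Suc n) -` A" by (simp add: funpow_swap1)
  qed
  moreover have "continuous_on ((f ^^ n) -` A) g"
    using assms(1) by (meson continuous_on_subset homeomorphism_def subset_UNIV)
  ultimately show ?case using connected_continuous_image[OF _ Suc] by (simp del: funpow.simps)
qed

section \<open>Radii supported on the return times\<close>

theorem theorem1p4:
  fixes \<nu> :: "circle measure" and f :: "circle \<Rightarrow> circle"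
  assumes "prob_space \<nu>" and "sets \<nu> = sets borel"
    and "nonatomic \<nu>"
    and "\<exists>g. homeomorphism UNIV UNIV f g"
    and "preserves_measure \<nu> f"
  shows "\<not> has_STP \<nu> f"
proof
  assume stp: "has_STP \<nu> f"
  interpret prob_space \<nu> by fact
  note sets = assms(2)
  have space: "space \<nu> = UNIV" using sets_eq_imp_space_eq[OF sets] by simp
  obtain g where g: "homeomorphism UNIV UNIV f g" using assms(4) by blast
  obtain x where x: "\<And>r. r > 0 \<Longrightarrow> emeasure \<nu> (ball x r) \<noteq> 0"
    using exists_support_point[OF sets] emeasure_space_1 by (auto simp: space)
  have "emeasure \<nu> {x} = 0" using nonatomic_singleton[OF assms(3)] by (simp add: sets)
  \<comment> \<open>The bound 1 / 4 is chosen because the set \<open>S\<close> below has measure at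
    most four times that of the ball.\<close>
  then obtain \<rho> where \<rho>: "\<rho> > 0" "measure \<nu> (ball x \<rho>) < 1 / 4"
    using exists_ball_small_measure[OF finite_measure_axioms sets, of x "1 / 4"] by auto
  define A where "A = ball x \<rho>"
  define m where "m = measure \<nu> A"
  have A: "A \<in> sets \<nu>" "x \<in> A" "connected A" "emeasure \<nu> A \<noteq> 0"
    using \<rho>(1) x by (auto simp: A_def sets connected_ball_circle)
  have m: "0 < m" "m < 1 / 4"
    using \<rho>(2) A(4) by (auto simp: m_def A_def emeasure_eq_measure zero_less_measure_iff)
  have inf: "\<exists>\<^sub>\<infinity>n. (f ^^ n) -` A \<inter> A \<noteq> {}"
    by (rule infinite_return_times[OF finite_measure_axioms assms(5) A(1,4)])
  \<comment> \<open>Radius 0 makes the target empty, so only return times contribute to the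
    limsup.\<close>
  define r where "r n = (if (f ^^ n) -` A \<inter> A \<noteq> {} then \<rho> else 0)" for n
  \<comment> \<open>The value \<open>m\<close> occurs infinitely often among the terms, which
    therefore do not tend to 0.\<close>
  have "(\<Sum>n. emeasure \<nu> (ball x (r n))) = \<infinity>"
  proof (rule ccontr)
    assume "(\<Sum>n. emeasure \<nu> (ball x (r n))) \<noteq> \<infinity>"
    then have "summable (\<lambda>n. measure \<nu> (ball x (r n)))"
      by (intro summable_suminf_not_top) (auto simp: emeasure_eq_measure)
    then have "eventually (\<lambda>n. measure \<nu> (ball x (r n)) < m) sequentially"
      using m(1) by (intro order_tendstoD(2)[OF summable_LIMSEQ_zero])
    then have "\<forall>\<^sub>\<infinity>n. \<not> (f ^^ n) -` A \<inter> A \<noteq> {}"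
      unfolding cofinite_eq_sequentially
      by (rule eventually_mono) (auto simp: r_def m_def A_def split: if_splits)
    then show False using inf by (simp add: frequently_def)
  qed
  moreover have "\<forall>n. r n \<ge> 0" using \<rho>(1) by (simp add: r_def)
  ultimately have full: "emeasure \<nu> {y. \<exists>\<^sub>\<infinity>n. y \<in> (f ^^ n) -` ball x (r n)} = 1"
    using stp emeasure_space_1 unfolding has_STP_def by simp
  \<comment> \<open>\<open>2 * m\<close> bounds the measure of \<open>A\<close> together with one
    preimage, which has measure \<open>m\<close> by invariance.\<close>
  obtain S where S: "S \<in> sets borel" "measure \<nu> S \<le> 2 * (2 * m)"
    "\<And>D. D \<in> sets borel \<Longrightarrow> connected D \<Longrightarrow> x \<in> D \<Longrightarrow> measure \<nu> D \<le> 2 * m \<Longrightarrow> D \<subseteq> S"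
    using measure_connected_through_point[OF finite_measure_axioms sets, of "2 * m" x] m by auto
  have return: "(f ^^ n) -` A \<subseteq> S" if n: "(f ^^ n) -` A \<inter> A \<noteq> {}" for n
  proof -
    have pre: "(f ^^ n) -` A \<in> sets \<nu>" "emeasure \<nu> ((f ^^ n) -` A) = emeasure \<nu> A"
      using preserves_measure_funpow[OF assms(5), of n] A(1) measurable_sets[of "f ^^ n" \<nu> \<nu> A]
      by (auto simp: preserves_measure_def space)
    \<comment> \<open>At a return time the two connected sets share a point.\<close>
    have "connected (A \<union> (f ^^ n) -` A)"
      using n A(3) connected_vimage_funpow[OF g A(3)] by (intro connected_Un) auto
    moreover have "measure \<nu> (A \<union> (f ^^ n) -` A) \<le> 2 * m"
      using measure_Un_le[OF A(1) pre(1)] pre(2) by (simp add: m_def measure_def)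
    moreover have "A \<union> (f ^^ n) -` A \<in> sets borel" using A(1) pre(1) sets by auto
    ultimately show ?thesis using S(3) A(2) by blast
  qed
  \<comment> \<open>Membership in one target suffices: that target is nonempty, so its time is a
    return time.\<close>
  have "{y. \<exists>\<^sub>\<infinity>n. y \<in> (f ^^ n) -` ball x (r n)} \<subseteq> S"
  proof
    fix y assume "y \<in> {y. \<exists>\<^sub>\<infinity>n. y \<in> (f ^^ n) -` ball x (r n)}"
    then obtain n where "y \<in> (f ^^ n) -` ball x (r n)" by (auto dest: frequently_ex)
    then show "y \<in> S" using return[of n] by (auto simp: r_def A_def split: if_splits)
  qed
  then have "emeasure \<nu> {y. \<exists>\<^sub>\<infinity>n. y \<in> (f ^^ n) -` ball x (r n)} \<le> emeasure \<nu> S"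
    by (rule emeasure_mono) (simp add: S(1) sets)
  then have "1 \<le> measure \<nu> S" unfolding full by (simp add: emeasure_eq_measure)
  then show False using S(2) m by linarith
qed

end
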